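(* Any vertical v-grim reaper, any parabolic p-grim reaper and any hyperbolic h-grim reaper of $\mathbb{H}^2\times\mathbb{R}$ is a minimal surface (i.e. $H=0$ identically).
   Context: $\mathbb{H}^2\times\mathbb{R}$ is $\{(x,y,z)\in\mathbb{R}^3: y>0\}$ with metric $\frac{dx^2+dy^2}{y^2}+dz^2$. For an orientable immersed surface $\Sigma$ with unit normal $N$, $H$ denotes the mean curvature with respect to $N$, i.e. half the trace of the second fundamental form $\langle N,\overline\nabla_{\cdot}\,\cdot\rangle$. $\Sigma$ is a v-translator if $H=\langle N,\partial_z\rangle$, a p-translator if $H=\langle N,\partial_x\rangle$, and an h-translator if $H=\langle N,x\partial_x+y\partial_y\rangle$. One-parameter groups of translations: vertical $(x,y,z)\mapsto(x,y,z+t)$; parabolic $(x,y,z)\mapsto(x+t,y,z)$; hyperbolic $(x,y,z)\mapsto(e^tx,e^ty,z)$, $t\in\mathbb{R}$. For $\delta\in\{\mathrm{v},\mathrm{p},\mathrm{h}\}$, a vertical (resp. parabolic, hyperbolic) $\delta$-grim reaper is a $\delta$-translator invariant by the one-parameter group of vertical (resp. parabolic, hyperbolic) translations. *)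

theory Defs
  imports "HOL-Analysis.Analysis"
begin

text \<open>A point \<open>(x, y, z)\<close> is \<open>p :: real^3\<close>. Tangent vectors are written in the coordinate frame
  \<open>(\<partial>\<^sub>x, \<partial>\<^sub>y, \<partial>\<^sub>z)\<close>, so that they are also elements of \<open>real^3\<close>.\<close>

definition H2xR :: "(real^3) set" where
  "H2xR = {p. p $ 2 > 0}"

definition amb_metric :: "real^3 \<Rightarrow> real^3 \<Rightarrow> real^3 \<Rightarrow> real" where
  "amb_metric p u v = (u $ 1 * v $ 1 + u $ 2 * v $ 2) / (p $ 2)^2 + u $ 3 * v $ 3"

definition partial :: "'n::finite \<Rightarrow> (real^'n \<Rightarrow> 'b::real_normed_vector) \<Rightarrow> real^'n \<Rightarrow> 'b" where
  "partial i f x = frechet_derivative f (at x) (axis i 1)"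

definition metric_matrix :: "real^3 \<Rightarrow> real^3^3" where
  "metric_matrix p = (\<chi> i j. amb_metric p (axis i 1) (axis j 1))"

definition christoffel :: "3 \<Rightarrow> 3 \<Rightarrow> 3 \<Rightarrow> real^3 \<Rightarrow> real" where
  "christoffel k i j p = 1/2 * (\<Sum>l\<in>UNIV. matrix_inv (metric_matrix p) $ k $ l *
     (partial i (\<lambda>q. metric_matrix q $ j $ l) p
      + partial j (\<lambda>q. metric_matrix q $ i $ l) p
      - partial l (\<lambda>q. metric_matrix q $ i $ j) p))"

text \<open>Intended for open domains \<open>S\<close> of finite-dimensional spaces.\<close>

primrec Ck_on :: "nat \<Rightarrow> 'a::real_normed_vector set \<Rightarrow> ('a \<Rightarrow> 'b::real_normed_vector) \<Rightarrow> bool" where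
  "Ck_on 0 S f \<longleftrightarrow> continuous_on S f"
| "Ck_on (Suc k) S f \<longleftrightarrow>
     (\<forall>x\<in>S. f differentiable (at x)) \<and> (\<forall>v. Ck_on k S (\<lambda>x. frechet_derivative f (at x) v))"

definition smooth_on :: "'a::real_normed_vector set \<Rightarrow> ('a \<Rightarrow> 'b::real_normed_vector) \<Rightarrow> bool" where
  "smooth_on S f \<longleftrightarrow> (\<forall>k. Ck_on k S f)"

text \<open>An atlas is a set of local parametrizations \<open>(D, \<psi>)\<close>, where \<open>\<psi>\<close> maps the open set
  \<open>D\<close> of the plane homeomorphically onto an open set of the surface.\<close>

type_synonym 'a chart = "(real^2) set \<times> (real^2 \<Rightarrow> 'a)"

definition second_countable :: "'a topology \<Rightarrow> bool" where
  "second_countable T \<longleftrightarrow> (\<exists>\<B>. countable \<B> \<and> (\<forall>V\<in>\<B>. openin T V) \<and>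
     (\<forall>U x. openin T U \<and> x \<in> U \<longrightarrow> (\<exists>V\<in>\<B>. x \<in> V \<and> V \<subseteq> U)))"

definition smooth_atlas :: "'a topology \<Rightarrow> 'a chart set \<Rightarrow> bool" where
  "smooth_atlas T A \<longleftrightarrow>
     (\<forall>(D, \<psi>)\<in>A. open D \<and> openin T (\<psi> ` D) \<and> embedding_map (top_of_set D) T \<psi>) \<and>
     (\<Union>(D, \<psi>)\<in>A. \<psi> ` D) = topspace T \<and>
     (\<forall>(D, \<psi>)\<in>A. \<forall>(E, \<xi>)\<in>A. smooth_on {u \<in> D. \<psi> u \<in> \<xi> ` E} (inv_into E \<xi> \<circ> \<psi>))"

text \<open>The unit normal is a field along the immersion: it is a function on the abstract surface
  and not on its image, which may have self-intersections.\<close>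

record 'a surface =
  top_of :: "'a topology"
  atlas :: "'a chart set"
  imm :: "'a \<Rightarrow> real^3"
  nrm :: "'a \<Rightarrow> real^3"

definition oriented_immersed_surface :: "'a surface \<Rightarrow> bool" where
  "oriented_immersed_surface \<Sigma> \<longleftrightarrow>
     Hausdorff_space (top_of \<Sigma>) \<and> second_countable (top_of \<Sigma>) \<and>
     smooth_atlas (top_of \<Sigma>) (atlas \<Sigma>) \<and>
     imm \<Sigma> ` topspace (top_of \<Sigma>) \<subseteq> H2xR \<and>
     (\<forall>(D, \<psi>)\<in>atlas \<Sigma>. smooth_on D (imm \<Sigma> \<circ> \<psi>) \<and>
        (\<forall>u\<in>D. inj (frechet_derivative (imm \<Sigma> \<circ> \<psi>) (at u)))) \<and>
     continuous_map (top_of \<Sigma>) euclidean (nrm \<Sigma>) \<and>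
     (\<forall>p\<in>topspace (top_of \<Sigma>). amb_metric (imm \<Sigma> p) (nrm \<Sigma> p) (nrm \<Sigma> p) = 1) \<and>
     (\<forall>(D, \<psi>)\<in>atlas \<Sigma>. \<forall>u\<in>D. \<forall>v.
        amb_metric (imm \<Sigma> (\<psi> u)) (nrm \<Sigma> (\<psi> u)) (frechet_derivative (imm \<Sigma> \<circ> \<psi>) (at u) v) = 0)"

text \<open>In the following, \<open>F\<close> is a local parametrization of an immersed surface with values in the
  ambient space.\<close>

definition first_form :: "(real^2 \<Rightarrow> real^3) \<Rightarrow> real^2 \<Rightarrow> real^2^2" where
  "first_form F u = (\<chi> i j. amb_metric (F u) (partial i F u) (partial j F u))"

text \<open>The Levi-Civita covariant derivative of the field \<open>\<partial>\<^sub>j F\<close> along \<open>F\<close> in the direction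
  \<open>\<partial>\<^sub>i F\<close>.\<close>

definition cov_deriv :: "(real^2 \<Rightarrow> real^3) \<Rightarrow> 2 \<Rightarrow> 2 \<Rightarrow> real^2 \<Rightarrow> real^3" where
  "cov_deriv F i j u = (\<chi> k. partial i (partial j F) u $ k +
     (\<Sum>a\<in>UNIV. \<Sum>b\<in>UNIV. christoffel k a b (F u) * partial i F u $ a * partial j F u $ b))"

definition second_form :: "(real^2 \<Rightarrow> real^3) \<Rightarrow> real^3 \<Rightarrow> real^2 \<Rightarrow> real^2^2" where
  "second_form F N u = (\<chi> i j. amb_metric (F u) N (cov_deriv F i j u))"

text \<open>Half the trace of the second fundamental form with respect to the induced metric. The value
  does not depend on the parametrization, so any one around the given point may be used.\<close>

definition local_mean_curvature :: "(real^2 \<Rightarrow> real^3) \<Rightarrow> real^3 \<Rightarrow> real^2 \<Rightarrow> real" where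
  "local_mean_curvature F N u = trace (matrix_inv (first_form F u) ** second_form F N u) / 2"

definition mean_curvature :: "'a surface \<Rightarrow> 'a \<Rightarrow> real" where
  "mean_curvature \<Sigma> p =
     (let (D, \<psi>) = (SOME (D, \<psi>). (D, \<psi>) \<in> atlas \<Sigma> \<and> p \<in> \<psi> ` D)
      in local_mean_curvature (imm \<Sigma> \<circ> \<psi>) (nrm \<Sigma> p) (inv_into D \<psi> p))"

definition minimal :: "'a surface \<Rightarrow> bool" where
  "minimal \<Sigma> \<longleftrightarrow> (\<forall>p\<in>topspace (top_of \<Sigma>). mean_curvature \<Sigma> p = 0)"

definition translator :: "(real^3 \<Rightarrow> real^3) \<Rightarrow> 'a surface \<Rightarrow> bool" where
  "translator V \<Sigma> \<longleftrightarrow> (\<forall>p\<in>topspace (top_of \<Sigma>).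
     mean_curvature \<Sigma> p = amb_metric (imm \<Sigma> p) (nrm \<Sigma> p) (V (imm \<Sigma> p)))"

definition v_translator :: "'a surface \<Rightarrow> bool" where
  "v_translator = translator (\<lambda>q. vector [0, 0, 1])"

definition p_translator :: "'a surface \<Rightarrow> bool" where
  "p_translator = translator (\<lambda>q. vector [1, 0, 0])"

definition h_translator :: "'a surface \<Rightarrow> bool" where
  "h_translator = translator (\<lambda>q. vector [q $ 1, q $ 2, 0])"

definition vertical_translation :: "real \<Rightarrow> real^3 \<Rightarrow> real^3" where
  "vertical_translation t q = vector [q $ 1, q $ 2, q $ 3 + t]"

definition parabolic_translation :: "real \<Rightarrow> real^3 \<Rightarrow> real^3" where
  "parabolic_translation t q = vector [q $ 1 + t, q $ 2, q $ 3]"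

definition hyperbolic_translation :: "real \<Rightarrow> real^3 \<Rightarrow> real^3" where
  "hyperbolic_translation t q = vector [exp t * q $ 1, exp t * q $ 2, q $ 3]"

text \<open>Only the image of the immersion is required to be invariant.\<close>

definition invariant_under :: "(real \<Rightarrow> real^3 \<Rightarrow> real^3) \<Rightarrow> 'a surface \<Rightarrow> bool" where
  "invariant_under \<phi> \<Sigma> \<longleftrightarrow>
     (\<forall>t. \<phi> t ` (imm \<Sigma> ` topspace (top_of \<Sigma>)) = imm \<Sigma> ` topspace (top_of \<Sigma>))"

definition vertical_v_grim_reaper :: "'a surface \<Rightarrow> bool" where
  "vertical_v_grim_reaper \<Sigma> \<longleftrightarrow> oriented_immersed_surface \<Sigma> \<and> v_translator \<Sigma> \<and>
     invariant_under vertical_translation \<Sigma>"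

definition parabolic_p_grim_reaper :: "'a surface \<Rightarrow> bool" where
  "parabolic_p_grim_reaper \<Sigma> \<longleftrightarrow> oriented_immersed_surface \<Sigma> \<and> p_translator \<Sigma> \<and>
     invariant_under parabolic_translation \<Sigma>"

definition hyperbolic_h_grim_reaper :: "'a surface \<Rightarrow> bool" where
  "hyperbolic_h_grim_reaper \<Sigma> \<longleftrightarrow> oriented_immersed_surface \<Sigma> \<and> h_translator \<Sigma> \<and>
     invariant_under hyperbolic_translation \<Sigma>"

end

theory Submission
  imports Defs
begin

text \<open>The translator equation reads \<open>H = \<langle>N, V\<rangle>\<close>, where \<open>V\<close> is the velocity field of the very group
  under which the surface is invariant. Hence it suffices that \<open>V\<close> is tangent to the surface: then
  \<open>\<langle>N, V\<rangle> = 0\<close> everywhere, and the surface is minimal.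

  Tangency is clear if the group acts on the abstract surface, but here only the image \<open>S\<close> of the
  immersion is invariant, and \<open>S\<close> may have many sheets through one point, which a priori could be
  permuted by the group. The argument is therefore one of measure. A second countable surface is
  covered by countably many charts, so \<open>S\<close> is a null set in space
  (\<open>negligible_image_of_surface\<close>). If \<open>V\<close> were transverse to the sheet through some point, then
  moving that sheet by the group would sweep out a neighbourhood of the point
  (\<open>interior_swept_by_transversal_flow\<close>); by invariance this neighbourhood would lie in \<open>S\<close>, which
  is impossible.\<close>

lemma smooth_on_imp_differentiable:
  assumes "smooth_on S f" "x \<in> S"
  shows "f differentiable (at x)"
  using assms Ck_on.simps(2) unfolding smooth_on_def by blast

text \<open>The members of a countable base that lie inside a single chart already cover the surface, and
  the immersion maps each of them into a smooth image of a plane region, which has measure zero.\<close>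

lemma negligible_image_of_surface:
  fixes \<Sigma> :: "'a surface"
  assumes "oriented_immersed_surface \<Sigma>"
  shows "negligible (imm \<Sigma> ` topspace (top_of \<Sigma>))"
proof -
  let ?T = "top_of \<Sigma>"
  have at: "smooth_atlas ?T (atlas \<Sigma>)" and sc: "second_countable ?T"
    and sm: "\<And>D \<psi>. (D, \<psi>) \<in> atlas \<Sigma> \<Longrightarrow> smooth_on D (imm \<Sigma> \<circ> \<psi>)"
    using assms unfolding oriented_immersed_surface_def by auto
  from sc obtain \<B> where cB: "countable \<B>"
    and base: "\<And>U x. openin ?T U \<Longrightarrow> x \<in> U \<Longrightarrow> \<exists>V\<in>\<B>. x \<in> V \<and> V \<subseteq> U"
    unfolding second_countable_def by metis
  define \<C> where "\<C> = {V\<in>\<B>. \<exists>(D, \<psi>)\<in>atlas \<Sigma>. V \<subseteq> \<psi> ` D}"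
  have "negligible (imm \<Sigma> ` V)" if V: "V \<in> \<C>" for V
  proof -
    obtain D \<psi> where ch: "(D, \<psi>) \<in> atlas \<Sigma>" and VD: "V \<subseteq> \<psi> ` D"
      using V unfolding \<C>_def by auto
    have "(imm \<Sigma> \<circ> \<psi>) differentiable_on D"
      using smooth_on_imp_differentiable[OF sm[OF ch]]
      by (simp add: differentiable_at_imp_differentiable_on)
    then have "negligible ((imm \<Sigma> \<circ> \<psi>) ` D)"
      by (intro negligible_differentiable_image_lowdim) auto
    moreover have "imm \<Sigma> ` V \<subseteq> (imm \<Sigma> \<circ> \<psi>) ` D"
      using VD by (auto simp: image_comp[symmetric])
    ultimately show ?thesis
      by (rule negligible_subset)
  qed
  moreover have "countable ((`) (imm \<Sigma>) ` \<C>)"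
    using cB unfolding \<C>_def by auto
  ultimately have "negligible (\<Union> ((`) (imm \<Sigma>) ` \<C>))"
    by (intro negligible_countable_Union) auto
  moreover have "imm \<Sigma> ` topspace ?T \<subseteq> \<Union> ((`) (imm \<Sigma>) ` \<C>)"
  proof
    fix q assume "q \<in> imm \<Sigma> ` topspace ?T"
    then obtain p where p: "p \<in> topspace ?T" and q: "q = imm \<Sigma> p"
      by auto
    have "p \<in> (\<Union>(D, \<psi>)\<in>atlas \<Sigma>. \<psi> ` D)"
      using at p unfolding smooth_atlas_def by blast
    then obtain D \<psi> where ch: "(D, \<psi>) \<in> atlas \<Sigma>" and pD: "p \<in> \<psi> ` D"
      by auto
    have "openin ?T (\<psi> ` D)"
      using at ch unfolding smooth_atlas_def by blast
    from base[OF this pD] obtain V where "V \<in> \<B>" "p \<in> V" "V \<subseteq> \<psi> ` D"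
      by auto
    then have "V \<in> \<C>"
      using ch unfolding \<C>_def by blast
    with \<open>p \<in> V\<close> show "q \<in> \<Union> ((`) (imm \<Sigma>) ` \<C>)"
      using q by auto
  qed
  ultimately show ?thesis
    by (rule negligible_subset)
qed

text \<open>The differential of \<open>(t, u) \<mapsto> \<phi>\<^sub>t (F u)\<close> at \<open>(0, u)\<close> is \<open>(s, v) \<mapsto> s W + dF v\<close>, so
  transversality makes it injective, hence onto by equality of dimensions. Sussmann's open mapping
  theorem needs surjectivity at this one point only, together with continuity nearby.\<close>

lemma interior_swept_by_transversal_flow:
  fixes F :: "'m::euclidean_space \<Rightarrow> 'n::euclidean_space" and \<phi> :: "real \<Rightarrow> 'n \<Rightarrow> 'n"
  assumes dim: "DIM('n) = Suc (DIM('m))"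
    and D: "open D" "u \<in> D"
    and F: "\<And>x. x \<in> D \<Longrightarrow> F differentiable (at x)"
    and inj: "inj (frechet_derivative F (at u))"
    and transversal: "W \<notin> range (frechet_derivative F (at u))"
    and cont: "continuous_on UNIV (\<lambda>(t, q). \<phi> t q)"
    and deriv: "((\<lambda>(t, q). \<phi> t q) has_derivative (\<lambda>(s, v). s *\<^sub>R W + v)) (at (0, F u))"
  shows "interior (\<Union>t. \<phi> t ` F ` D) \<noteq> {}"
proof -
  define L where "L = frechet_derivative F (at u)"
  define G where "G = (\<lambda>(t, x). \<phi> t (F x))"
  define G' where "G' = (\<lambda>(s::real, v). s *\<^sub>R W + L v)"
  have dF: "(F has_derivative L) (at u)"
    unfolding L_def using F[OF D(2)] frechet_derivative_works by blast
  have linL: "linear L"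
    using dF has_derivative_linear by blast
  have contF: "continuous_on D F"
    using F by (meson continuous_at_imp_continuous_on differentiable_imp_continuous_within)
  have "continuous_on (UNIV \<times> D) ((\<lambda>(t, q). \<phi> t q) \<circ> (\<lambda>x. (fst x, F (snd x))))"
    by (intro continuous_on_compose continuous_on_subset[OF cont] continuous_on_Pair
        continuous_on_fst continuous_on_id continuous_on_compose2[OF contF] continuous_on_snd) auto
  then have contG: "continuous_on (UNIV \<times> D) G"
    by (simp add: G_def o_def case_prod_unfold)
  have dpair: "((\<lambda>x. (fst x, F (snd x))) has_derivative (\<lambda>x. (fst x, L (snd x)))) (at (0::real, u))"
  proof -
    have "((\<lambda>x. F (snd x)) has_derivative (\<lambda>x. L (snd x))) (at (0::real, u))"
      using has_derivative_compose[of snd snd "(0::real, u)" UNIV F L] dF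
      by (simp add: has_derivative_snd)
    then show ?thesis
      by (intro has_derivative_Pair has_derivative_fst has_derivative_ident)
  qed
  have dG: "(G has_derivative G') (at (0, u))"
    using has_derivative_compose[OF dpair, of "\<lambda>(t, q). \<phi> t q" "\<lambda>(s, v). s *\<^sub>R W + v"] deriv
    by (simp add: G_def G'_def case_prod_unfold)
  have linG': "linear G'"
    using dG has_derivative_linear by blast
  have "inj G'"
  proof (subst linear_injective_0[OF linG'], intro allI impI)
    fix x assume x: "G' x = 0"
    obtain s v where sv: "x = (s, v)"
      by (cases x)
    have e: "L v = - (s *\<^sub>R W)"
      using x sv by (simp add: G'_def eq_neg_iff_add_eq_0 add.commute)
    have "s = 0"
    proof (rule ccontr)
      assume "s \<noteq> 0"
      then have "W = L ((- inverse s) *\<^sub>R v)"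
        using e linear_scale[OF linL] linear_neg[OF linL] by simp
      then show False
        using transversal unfolding L_def by blast
    qed
    moreover from this have "v = 0"
      using e inj linL linear_injective_0 unfolding L_def by auto
    ultimately show "x = 0"
      using sv by (simp add: zero_prod_def)
  qed
  then have "surj G'"
    using linG' dim by (intro linear_injective_imp_surjective) auto
  then obtain g' where g': "linear g'" "G' \<circ> g' = id"
    using linear_surjective_right_inverse linG' by blast
  have "G (0, u) \<in> interior (G ` (UNIV \<times> D))"
    by (rule sussmann_open_mapping[OF _ contG _ dG _ g'(2)])
       (use D g'(1) in \<open>auto simp: open_Times interior_open linear_conv_bounded_linear\<close>)
  moreover have "G ` (UNIV \<times> D) = (\<Union>t. \<phi> t ` F ` D)"
    by (auto simp: G_def)
  ultimately show ?thesis
    by auto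
qed

text \<open>The hypothesis \<open>deriv\<close> says that \<open>W\<close> is the velocity of the group at \<open>imm \<Sigma> p\<close>. A normal
  component of \<open>W\<close> would make the chart around \<open>p\<close> sweep out an open set inside the invariant
  image, contradicting that the image is a null set.\<close>

lemma velocity_of_invariance_group_is_tangent:
  fixes \<Sigma> :: "'a surface"
  assumes surf: "oriented_immersed_surface \<Sigma>" and inv: "invariant_under \<phi> \<Sigma>"
    and p: "p \<in> topspace (top_of \<Sigma>)"
    and cont: "continuous_on UNIV (\<lambda>(t, q). \<phi> t q)"
    and deriv: "((\<lambda>(t, q). \<phi> t q) has_derivative (\<lambda>(s, v). s *\<^sub>R W + v)) (at (0, imm \<Sigma> p))"
  shows "amb_metric (imm \<Sigma> p) (nrm \<Sigma> p) W = 0"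
proof (rule ccontr)
  assume normal_part: "amb_metric (imm \<Sigma> p) (nrm \<Sigma> p) W \<noteq> 0"
  let ?T = "top_of \<Sigma>"
  have at: "smooth_atlas ?T (atlas \<Sigma>)"
    using surf unfolding oriented_immersed_surface_def by blast
  have "p \<in> (\<Union>(D, \<psi>)\<in>atlas \<Sigma>. \<psi> ` D)"
    using at p unfolding smooth_atlas_def by blast
  then obtain D \<psi> u where ch: "(D, \<psi>) \<in> atlas \<Sigma>" and u: "u \<in> D" "p = \<psi> u"
    by auto
  let ?F = "imm \<Sigma> \<circ> \<psi>"
  have "open D" and DT: "\<psi> ` D \<subseteq> topspace ?T"
    using at ch unfolding smooth_atlas_def by (blast, fastforce)
  have diff: "?F differentiable (at x)" if "x \<in> D" for x
    using surf ch smooth_on_imp_differentiable[OF _ that]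
    unfolding oriented_immersed_surface_def by blast
  have inj: "inj (frechet_derivative ?F (at u))"
    using surf ch u unfolding oriented_immersed_surface_def by blast
  have "amb_metric (imm \<Sigma> p) (nrm \<Sigma> p) (frechet_derivative ?F (at u) v) = 0" for v
    using surf ch u unfolding oriented_immersed_surface_def by blast
  then have "W \<notin> range (frechet_derivative ?F (at u))"
    using normal_part by auto
  then have "interior (\<Union>t. \<phi> t ` ?F ` D) \<noteq> {}"
    using interior_swept_by_transversal_flow[OF _ \<open>open D\<close> u(1) diff inj _ cont, of W] deriv u(2)
    by simp
  moreover have "(\<Union>t. \<phi> t ` ?F ` D) \<subseteq> imm \<Sigma> ` topspace ?T"
    using DT inv unfolding invariant_under_def by (fastforce simp: image_comp[symmetric])
  then have "negligible (\<Union>t. \<phi> t ` ?F ` D)"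
    using negligible_image_of_surface[OF surf] negligible_subset by blast
  ultimately show False
    using open_not_negligible[OF open_interior] negligible_subset[OF _ interior_subset] by blast
qed

lemma translator_of_invariance_group_is_minimal:
  fixes \<Sigma> :: "'a surface"
  assumes "oriented_immersed_surface \<Sigma>" "invariant_under \<phi> \<Sigma>" "translator V \<Sigma>"
    and "continuous_on UNIV (\<lambda>(t, q). \<phi> t q)"
    and "\<And>q. ((\<lambda>(t, q). \<phi> t q) has_derivative (\<lambda>(s, v). s *\<^sub>R V q + v)) (at (0, q))"
  shows "minimal \<Sigma>"
  using assms velocity_of_invariance_group_is_tangent
  unfolding minimal_def translator_def by metis

text \<open>Vector expressions of the three groups and their velocity fields, to which the rules for
  continuity and differentiation apply.\<close>

lemma vector_velocity_fields:
  "(vector [0, 0, 1] :: real^3) = axis 3 1"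
  "(vector [1, 0, 0] :: real^3) = axis 1 1"
  "vector [q $ 1, q $ 2, 0] = q - q $ 3 *\<^sub>R (axis 3 1 :: real^3)"
  by (auto simp: vec_eq_iff forall_3 axis_def)

lemma vector_translations:
  "vertical_translation t q = q + t *\<^sub>R axis 3 1"
  "parabolic_translation t q = q + t *\<^sub>R axis 1 1"
  "hyperbolic_translation t q = q + (exp t - 1) *\<^sub>R (q - q $ 3 *\<^sub>R axis 3 1)"
  by (auto simp: vertical_translation_def parabolic_translation_def hyperbolic_translation_def
      vec_eq_iff forall_3 axis_def algebra_simps)

theorem theorem3p1:
  fixes \<Sigma> :: "'a surface"
  shows "(vertical_v_grim_reaper \<Sigma> \<longrightarrow> minimal \<Sigma>) \<and>
         (parabolic_p_grim_reaper \<Sigma> \<longrightarrow> minimal \<Sigma>) \<and>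
         (hyperbolic_h_grim_reaper \<Sigma> \<longrightarrow> minimal \<Sigma>)"
proof (intro conjI impI)
  assume "vertical_v_grim_reaper \<Sigma>"
  then have *: "oriented_immersed_surface \<Sigma>" "invariant_under vertical_translation \<Sigma>"
    "translator (\<lambda>q. vector [0, 0, 1]) \<Sigma>"
    by (auto simp: vertical_v_grim_reaper_def v_translator_def)
  show "minimal \<Sigma>"
    by (rule translator_of_invariance_group_is_minimal[OF *];
        unfold vector_translations vector_velocity_fields case_prod_unfold)
       (auto intro!: continuous_intros derivative_eq_intros)
next
  assume "parabolic_p_grim_reaper \<Sigma>"
  then have *: "oriented_immersed_surface \<Sigma>" "invariant_under parabolic_translation \<Sigma>"
    "translator (\<lambda>q. vector [1, 0, 0]) \<Sigma>"
    by (auto simp: parabolic_p_grim_reaper_def p_translator_def)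
  show "minimal \<Sigma>"
    by (rule translator_of_invariance_group_is_minimal[OF *];
        unfold vector_translations vector_velocity_fields case_prod_unfold)
       (auto intro!: continuous_intros derivative_eq_intros)
next
  assume "hyperbolic_h_grim_reaper \<Sigma>"
  then have *: "oriented_immersed_surface \<Sigma>" "invariant_under hyperbolic_translation \<Sigma>"
    "translator (\<lambda>q. vector [q $ 1, q $ 2, 0]) \<Sigma>"
    by (auto simp: hyperbolic_h_grim_reaper_def h_translator_def)
  show "minimal \<Sigma>"
    by (rule translator_of_invariance_group_is_minimal[OF *];
        unfold vector_translations vector_velocity_fields case_prod_unfold)
       (auto intro!: continuous_intros derivative_eq_intros
          bounded_linear.has_derivative[OF bounded_linear_vec_nth])
qed

end
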